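(* Let $p$ be a prime power, let $m\in\mathbb{N}$, and let $\Theta(t)=t^{-1}\sum_{i\ge0}s_it^{-i}\in\mathbb{F}_p(\!(t^{-1})\!)$ be a quadratic irrational. Let $\mathbf{X}$ be a finite alphabet containing symbols $0$ and $A$, let $\zeta$ be a two-dimensional $[p,p]$-morphism on $\mathbf{X}$ for which $A$ is $\zeta$-prolongable, and let $\xi$ be a two-dimensional $[m,m]$-coding from $\mathbf{X}$ to $\{0,1\}$. Assume $\xi(0)$ is the $m\times m$ zero block, $\zeta(0)$ is the $p\times p$ block of $0$'s, and the profile of the number wall of $\Theta$ equals $\xi(\zeta^\infty(A))$. If $\lim_{k\to\infty}\frac{N_0(\zeta^k(A))}{p^{2k}}=1$, then for every $\varepsilon>0$, $\lim_{n\to\infty}d(\{k\in\mathbb{N}:e_{k,n}(\Theta(t))>1-\varepsilon\})=1$.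
   Context: A two-dimensional $[k,l]$-coding $\tau$ from alphabet $\Sigma$ to alphabet $\Delta$ assigns to each letter a $k\times l$ matrix over $\Delta$ and acts on a finite or infinite matrix of letters by replacing each letter with its block (blockwise substitution); it is a $[k,l]$-morphism if $\Delta=\Sigma$. A letter $A$ is $\zeta$-prolongable if the $(0,0)$ entry of $\zeta(A)$ is $A$; then $\zeta^\infty(A)=\lim_k\zeta^k(A)$ is an infinite matrix indexed by $\mathbb{N}_0\times\mathbb{N}_0$. $N_0(B)$ is the number of occurrences of the letter $0$ in a block $B$. Number wall: with $s_i=0$ for $i<0$, $W[m,n]=\det(s_{n-i+j})_{0\le i,j\le m}$ for $m\ge0$; its profile is the array indexed by $m,n\ge0$ with entry $0$ where $W[m,n]=0$ and $1$ otherwise. $e_{k,n}(\Theta):=\frac{\sum_{i=1}^{\ell_k}\max\{\deg A_i^{[\Theta t^k]}-n,0\}}{\sum_{i=1}^{\ell_k}\deg A_i^{[\Theta t^k]}}$, where $\ell_k$ is the period length of the eventually periodic continued fraction of $\Theta t^k$ and $A_1^{[\Theta t^k]},\dots,A_{\ell_k}^{[\Theta t^k]}$ its partial quotients over one period. For $S\subseteq\mathbb{N}$, $d(S)=\lim_{M\to\infty}|S\cap\{1,\dots,M\}|/M$. *)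

theory Defs
  imports "HOL-Computational_Algebra.Formal_Laurent_Series"
          "HOL-Computational_Algebra.Primes"
          "Jordan_Normal_Form.Determinant"
begin

(* Convention: F_p((t^{-1})) is 'a fls, whose formal variable fls_X is t^{-1};
   hence t = fls_X_inv. *)

definition theta_of :: "(nat \<Rightarrow> 'a::field) \<Rightarrow> 'a fls" where
  "theta_of s = fls_X * fps_to_fls (Abs_fps s)"

definition poly_t :: "'a::field poly \<Rightarrow> 'a fls" where
  "poly_t P = (\<Sum>i\<le>degree P. fls_const (coeff P i) * fls_X_inv ^ i)"

definition is_rational_t :: "'a::field fls \<Rightarrow> bool" where
  "is_rational_t x \<longleftrightarrow> (\<exists>P Q. Q \<noteq> 0 \<and> x * poly_t Q = poly_t P)"

definition quadratic_irrational_t :: "'a::field fls \<Rightarrow> bool" where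
  "quadratic_irrational_t x \<longleftrightarrow> \<not> is_rational_t x \<and>
     (\<exists>a b c. (a, b, c) \<noteq> (0, 0, 0) \<and> poly_t a * x\<^sup>2 + poly_t b * x + poly_t c = 0)"

(* polynomial (integer) part in t: coefficient of t^i is x $$ (-i) *)
definition int_part_t :: "'a::field fls \<Rightarrow> 'a poly" where
  "int_part_t x = fls_prpart x + [: fls_nth x 0 :]"

fun cf_rest :: "'a::field fls \<Rightarrow> nat \<Rightarrow> 'a fls" where
  "cf_rest x 0 = x"
| "cf_rest x (Suc i) = inverse (cf_rest x i - poly_t (int_part_t (cf_rest x i)))"

definition cf_pq :: "'a::field fls \<Rightarrow> nat \<Rightarrow> 'a poly" where
  "cf_pq x i = int_part_t (cf_rest x i)"

definition cf_period :: "'a::field fls \<Rightarrow> nat" where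
  "cf_period x = (LEAST l. l > 0 \<and> (\<exists>N. \<forall>i\<ge>N. cf_pq x (i + l) = cf_pq x i))"

definition cf_preperiod :: "'a::field fls \<Rightarrow> nat" where
  "cf_preperiod x = (LEAST N. \<forall>i\<ge>N. cf_pq x (i + cf_period x) = cf_pq x i)"

definition e_kn :: "'a::field fls \<Rightarrow> nat \<Rightarrow> nat \<Rightarrow> real" where
  "e_kn th k n =
    (let x = th * fls_X_inv ^ k; N = cf_preperiod x; l = cf_period x in
      (\<Sum>i\<in>{N..<N+l}. max (real (degree (cf_pq x i)) - real n) 0) /
      (\<Sum>i\<in>{N..<N+l}. real (degree (cf_pq x i))))"

definition seq_ext :: "(nat \<Rightarrow> 'a::zero) \<Rightarrow> int \<Rightarrow> 'a" where
  "seq_ext s x = (if x < 0 then 0 else s (nat x))"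

definition number_wall :: "(nat \<Rightarrow> 'a::comm_ring_1) \<Rightarrow> nat \<Rightarrow> nat \<Rightarrow> 'a" where
  "number_wall s m n =
     det (mat (Suc m) (Suc m) (\<lambda>(i, j). seq_ext s (int n - int i + int j)))"

definition wall_profile :: "(nat \<Rightarrow> 'a::comm_ring_1) \<Rightarrow> nat \<Rightarrow> nat \<Rightarrow> nat" where
  "wall_profile s m n = (if number_wall s m n = 0 then 0 else 1)"

(* two-dimensional [p,p]-morphism zeta : 'x => (p x p block), blocks as nat => nat => 'x
   (only entries with indices < p are meaningful); iterate zeta^k(a) is a p^k x p^k block *)
fun morph_pow :: "nat \<Rightarrow> ('x \<Rightarrow> nat \<Rightarrow> nat \<Rightarrow> 'x) \<Rightarrow> nat \<Rightarrow> 'x \<Rightarrow> nat \<Rightarrow> nat \<Rightarrow> 'x" where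
  "morph_pow p \<zeta> 0 a = (\<lambda>i j. a)"
| "morph_pow p \<zeta> (Suc k) a =
     (\<lambda>i j. \<zeta> (morph_pow p \<zeta> k a (i div p) (j div p)) (i mod p) (j mod p))"

definition prolongable :: "nat \<Rightarrow> ('x \<Rightarrow> nat \<Rightarrow> nat \<Rightarrow> 'x) \<Rightarrow> 'x \<Rightarrow> bool" where
  "prolongable p \<zeta> a \<longleftrightarrow> \<zeta> a 0 0 = a"

(* zeta^infinity(a): for a prolongable letter the blocks zeta^k(a) are nested prefixes
   of one another, and entry (i,j) is stable as soon as p^k > max i j
   (true for k = max i j + 1 as p >= 2) *)
definition morph_inf :: "nat \<Rightarrow> ('x \<Rightarrow> nat \<Rightarrow> nat \<Rightarrow> 'x) \<Rightarrow> 'x \<Rightarrow> nat \<Rightarrow> nat \<Rightarrow> 'x" where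
  "morph_inf p \<zeta> a i j = morph_pow p \<zeta> (Suc (max i j)) a i j"

definition apply_coding :: "nat \<Rightarrow> ('x \<Rightarrow> nat \<Rightarrow> nat \<Rightarrow> 'b) \<Rightarrow> (nat \<Rightarrow> nat \<Rightarrow> 'x) \<Rightarrow> nat \<Rightarrow> nat \<Rightarrow> 'b" where
  "apply_coding m \<xi> M i j = \<xi> (M (i div m) (j div m)) (i mod m) (j mod m)"

definition count_letter :: "nat \<Rightarrow> ('x \<Rightarrow> nat \<Rightarrow> nat \<Rightarrow> 'x) \<Rightarrow> nat \<Rightarrow> 'x \<Rightarrow> 'x \<Rightarrow> nat" where
  "count_letter p \<zeta> k a z =
     card {(i, j). i < p ^ k \<and> j < p ^ k \<and> morph_pow p \<zeta> k a i j = z}"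

definition has_nat_density :: "nat set \<Rightarrow> real \<Rightarrow> bool" where
  "has_nat_density S d \<longleftrightarrow>
     ((\<lambda>M. real (card (S \<inter> {1..M})) / real M) \<longlonglongrightarrow> d)"

end

(* Write H_r(k) for the Hankel determinant of order r of Theta t^k, which up to sign is the wall entry
   in row r - 1 on the diagonal n - m = k. It is nonzero whenever r is the degree of a convergent
   denominator, by the best approximation property. Hence along this diagonal the nonzero entries
   have asymptotic density at least l_k / (sum of deg A_i over a period), and e_{k,n} <= 1 - eps forces
   this density to be at least eps / n. On the other hand every letter B of zeta^infinity(A) occurs in
   a fixed zeta^J(A), so the proportion of letters other than 0 in zeta^K(B) tends to 0 uniformly in B.
   Covering the strip of the diagonals k < N by blocks of size m p^K, all rows included, therefore
   leaves only o(N) exceptional k: the density in question is 1 for every n, not only in the limit.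
   The continued fractions are eventually periodic by Lagrange's argument. *)

theory Submission
  imports Defs
begin

subsection \<open>Continued fractions and Hankel determinants\<close>

no_notation index_mat (infixl "$$" 100)
notation fls_nth (infixl "$$" 75)

lemma poly_t_nth:
  "poly_t P $$ n = (if n \<le> 0 then coeff P (nat (- n)) else 0)"
proof -
  have "poly_t P $$ n = (\<Sum>i\<le>degree P. if n = - int i then coeff P i else 0)"
    unfolding poly_t_def fls_nth_sum by (intro sum.cong) (auto simp: fls_mult_const_nth)
  also have "\<dots> = (if n \<le> 0 then coeff P (nat (- n)) else 0)"
  proof (cases "n \<le> 0 \<and> nat (- n) \<le> degree P")
    case True
    then have "(\<Sum>i\<le>degree P. if n = - int i then coeff P i else 0)
        = (\<Sum>i\<le>degree P. if i = nat (- n) then coeff P i else 0)"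
      by (intro sum.cong) auto
    with True show ?thesis by simp
  next
    case False
    then have "(\<Sum>i\<le>degree P. if n = - int i then coeff P i else 0) = 0"
      by (intro sum.neutral) auto
    with False show ?thesis by (auto simp: coeff_eq_0)
  qed
  finally show ?thesis .
qed

lemma poly_t_0 [simp]: "poly_t 0 = 0"
  and poly_t_1 [simp]: "poly_t 1 = 1"
  and poly_t_add: "poly_t (P + Q) = poly_t P + poly_t Q"
  and poly_t_diff: "poly_t (P - Q) = poly_t P - poly_t Q"
  and poly_t_minus: "poly_t (- P) = - poly_t P"
  by (auto simp: fls_eq_iff poly_t_nth)

lemma poly_t_smult: "poly_t (Polynomial.smult a P) = fls_const a * poly_t P"
  by (auto simp: fls_eq_iff poly_t_nth)

lemma poly_t_pCons: "poly_t (pCons a P) = fls_const a + fls_X_inv * poly_t P"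
proof (rule fls_eqI)
  fix n
  have "nat (- n) = Suc (nat (- n - 1))" if "n < 0" using that by simp
  then show "poly_t (pCons a P) $$ n = (fls_const a + fls_X_inv * poly_t P) $$ n"
    by (auto simp: poly_t_nth fls_X_inv_times_conv_shift)
qed

lemma poly_t_mult: "poly_t (P * Q) = poly_t P * poly_t Q"
  by (induction P) (simp_all add: poly_t_pCons poly_t_add poly_t_smult algebra_simps)

lemma poly_t_monom: "poly_t (Polynomial.monom 1 k) = fls_X_inv ^ k"
  by (induction k) (simp_all add: monom_0 monom_Suc poly_t_pCons flip: one_pCons)

lemma poly_t_eq_iff [simp]: "poly_t P = poly_t Q \<longleftrightarrow> P = Q"
proof
  assume "poly_t P = poly_t Q"
  then have "poly_t P $$ (- int n) = poly_t Q $$ (- int n)" for n by simp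
  then show "P = Q" by (simp add: poly_t_nth poly_eq_iff)
qed simp

lemma poly_t_eq_0_iff [simp]: "poly_t P = 0 \<longleftrightarrow> P = 0"
  using poly_t_eq_iff[of P 0] by (simp del: poly_t_eq_iff)

lemma poly_t_mult_nth:
  "(poly_t Q * f) $$ n = (\<Sum>i\<le>degree Q. coeff Q i * f $$ (n + int i))"
proof -
  have "poly_t Q * f = (\<Sum>i\<le>degree Q. fls_const (coeff Q i) * (fls_X_inv ^ i * f))"
    by (simp add: poly_t_def sum_distrib_right mult.assoc)
  then show ?thesis by (simp add: fls_nth_sum fls_X_inv_power_times_conv_shift fls_mult_const_nth)
qed

lemma int_part_t_coeff: "coeff (int_part_t x) n = x $$ (- int n)"
  by (cases n) (auto simp: int_part_t_def)

lemma frac_part_nth: "(x - poly_t (int_part_t x)) $$ n = (if n \<le> 0 then 0 else x $$ n)"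
  by (auto simp: poly_t_nth int_part_t_coeff)

text \<open>\<open>val_ge x N\<close> encodes $|x| \<le> |t|^{-N}$ without a case distinction for $x = 0$.\<close>

definition val_ge :: "'a::zero fls \<Rightarrow> int \<Rightarrow> bool" where
  "val_ge x N \<longleftrightarrow> (\<forall>n<N. x $$ n = 0)"

lemma val_ge_iff: "val_ge x N \<longleftrightarrow> x = 0 \<or> N \<le> fls_subdegree x"
  unfolding val_ge_def by (metis fls_subdegree_geI fls_eq0_below_subdegree fls_zero_nth order_less_le_trans)

lemma val_ge_mono: "val_ge x N \<Longrightarrow> M \<le> N \<Longrightarrow> val_ge x M"
  by (auto simp: val_ge_def)

lemma
  fixes x y :: "'a::comm_ring_1 fls"
  shows val_ge_add: "val_ge x N \<Longrightarrow> val_ge y N \<Longrightarrow> val_ge (x + y) N"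
    and val_ge_diff: "val_ge x N \<Longrightarrow> val_ge y N \<Longrightarrow> val_ge (x - y) N"
    and val_ge_minus: "val_ge x N \<Longrightarrow> val_ge (- x) N"
  by (auto simp: val_ge_def)

lemma val_ge_mult: "val_ge x M \<Longrightarrow> val_ge y N \<Longrightarrow> val_ge (x * y) (M + N)" for x :: "'a::field fls"
  by (cases "x = 0 \<or> y = 0") (auto simp: val_ge_iff)

lemma val_ge_poly_t: "val_ge (poly_t P) (- int n) \<longleftrightarrow> degree P \<le> n"
proof
  assume "val_ge (poly_t P) (- int n)"
  then have "coeff P i = 0" if "i > n" for i
    using that by (auto simp: val_ge_def poly_t_nth dest: spec[of _ "- int i"])
  then show "degree P \<le> n" by (intro degree_le) auto
next
  assume "degree P \<le> n"
  then show "val_ge (poly_t P) (- int n)" by (auto simp: val_ge_def poly_t_nth intro!: coeff_eq_0)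
qed

lemma val_ge_1_poly_t: "val_ge (poly_t P) 1 \<Longrightarrow> P = 0"
proof (rule poly_eqI)
  fix n
  assume "val_ge (poly_t P) 1"
  then have "poly_t P $$ (- int n) = 0" by (simp add: val_ge_def)
  then show "coeff P n = coeff 0 n" by (simp add: poly_t_nth)
qed

lemma val_ge_frac_part: "val_ge (x - poly_t (int_part_t x)) 1"
  by (auto simp: val_ge_def frac_part_nth simp del: fls_minus_nth)

lemma degree_int_part_t: "fls_subdegree x \<le> 0 \<Longrightarrow> int (degree (int_part_t x)) = - fls_subdegree x"
proof (cases "x = 0")
  case False
  assume "fls_subdegree x \<le> 0"
  then have "degree (int_part_t x) = nat (- fls_subdegree x)"
    using False by (intro antisym degree_le le_degree) (auto simp: int_part_t_coeff)
  with \<open>fls_subdegree x \<le> 0\<close> show ?thesis by simp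
qed (simp add: int_part_t_def)

lemma is_rational_tI: "Q \<noteq> 0 \<Longrightarrow> x * poly_t Q = poly_t P \<Longrightarrow> is_rational_t x"
  by (auto simp: is_rational_t_def)

lemma irrational_diff_neq_0: "\<not> is_rational_t x \<Longrightarrow> x - poly_t A \<noteq> 0"
  using is_rational_tI[of 1 x A] by auto

lemma irrational_inverse_diff:
  assumes "\<not> is_rational_t x"
  shows "\<not> is_rational_t (inverse (x - poly_t A))"
proof
  assume "is_rational_t (inverse (x - poly_t A))"
  then obtain P Q where PQ: "Q \<noteq> 0" "inverse (x - poly_t A) * poly_t Q = poly_t P"
    by (auto simp: is_rational_t_def)
  have nz: "x - poly_t A \<noteq> 0" using irrational_diff_neq_0[OF assms] .
  have "poly_t P * (x - poly_t A) = poly_t Q * (inverse (x - poly_t A) * (x - poly_t A))"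
    unfolding PQ(2)[symmetric] by (simp only: mult_ac)
  then have "poly_t Q = poly_t P * (x - poly_t A)" by (simp only: left_inverse[OF nz] mult_1_right)
  then have eq: "x * poly_t P = poly_t (Q + A * P)"
    by (simp add: poly_t_add poly_t_mult algebra_simps)
  have "P \<noteq> 0" using PQ nz by auto
  with eq assms show False using is_rational_tI by blast
qed

lemma irrational_cf_rest: "\<not> is_rational_t x \<Longrightarrow> \<not> is_rational_t (cf_rest x i)"
  by (induction i) (simp_all add: irrational_inverse_diff)

lemma cf_rest_add: "cf_rest x (i + n) = cf_rest (cf_rest x i) n"
  by (induction n) simp_all

lemma cf_pq_add: "cf_pq x (i + n) = cf_pq (cf_rest x i) n"
  by (simp add: cf_pq_def cf_rest_add)

lemma fls_subdegree_cf_rest_Suc: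
  assumes "\<not> is_rational_t x"
  shows "fls_subdegree (cf_rest x (Suc i)) = - int (degree (cf_pq x (Suc i)))"
    and "0 < degree (cf_pq x (Suc i))"
proof -
  let ?f = "cf_rest x i - poly_t (int_part_t (cf_rest x i))"
  have "?f \<noteq> 0" using irrational_diff_neq_0[OF irrational_cf_rest[OF assms]] .
  then have "fls_subdegree ?f \<ge> 1" using val_ge_frac_part[of "cf_rest x i"] by (auto simp: val_ge_iff)
  then have neg: "fls_subdegree (cf_rest x (Suc i)) < 0"
    by (simp add: fls_inverse_subdegree)
  show eq: "fls_subdegree (cf_rest x (Suc i)) = - int (degree (cf_pq x (Suc i)))"
    using neg degree_int_part_t[of "cf_rest x (Suc i)"] unfolding cf_pq_def by linarith
  show "0 < degree (cf_pq x (Suc i))" using neg eq by linarith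
qed

text \<open>With $r = \deg Q_n$ this is the best approximation property of the $n$-th convergent; the
  induction peels off the first partial quotient, replacing $Qx - P$ by $(Q - (P - QA)y)/y$
  where $x = A + 1/y$.\<close>

lemma best_approximation:
  assumes "\<not> is_rational_t x"
    and "r = (\<Sum>i=1..n. degree (cf_pq x i))"
    and "val_ge (poly_t Q) (1 - int r)"
    and "val_ge (poly_t Q * x - poly_t P) (int r + 1)"
  shows "Q = 0"
  using assms
proof (induction n arbitrary: x r P Q)
  case 0
  then show ?case using val_ge_1_poly_t[of Q] by simp
next
  case (Suc n)
  define B where "B = int_part_t x"
  define y where "y = cf_rest x 1"
  define d where "d = degree (cf_pq x 1)"
  have irr: "\<not> is_rational_t y" unfolding y_def using irrational_cf_rest[OF Suc.prems(1)] .
  have nz: "x - poly_t B \<noteq> 0" using irrational_diff_neq_0[OF Suc.prems(1)] .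
  have ydef: "y = inverse (x - poly_t B)" by (simp add: y_def B_def)
  then have y0: "y \<noteq> 0" using nz by simp
  have suby: "fls_subdegree y = - int d"
    using fls_subdegree_cf_rest_Suc(1)[OF Suc.prems(1), of 0] by (simp add: y_def d_def)
  have subiy: "fls_subdegree (inverse y) = int d" using suby y0 by (simp add: fls_inverse_subdegree)
  define r' where "r' = (\<Sum>i=1..n. degree (cf_pq y i))"
  have shift: "cf_pq x (Suc i) = cf_pq y i" for i
    unfolding y_def using cf_pq_add[of x 1 i] by (simp only: plus_1_eq_Suc)
  have "r = (\<Sum>i=Suc 0..Suc n. degree (cf_pq x i))"
    using Suc.prems(2) by (simp only: One_nat_def)
  also have "\<dots> = d + (\<Sum>i=Suc (Suc 0)..Suc n. degree (cf_pq x i))"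
    unfolding d_def One_nat_def by (rule sum.atLeast_Suc_atMost) simp
  also have "\<dots> = d + r'"
    unfolding sum.shift_bounds_cl_Suc_ivl shift r'_def One_nat_def ..
  finally have r: "r = d + r'" .
  define Q' where "Q' = P - Q * B"
  have xy: "x = poly_t B + inverse y" using ydef by simp
  have e1: "poly_t Q' = poly_t Q * inverse y - (poly_t Q * x - poly_t P)"
  proof -
    have "p - q * b = q * i - (q * (b + i) - p)" for p q b i :: "'a fls"
      by (simp add: algebra_simps)
    then show ?thesis unfolding Q'_def poly_t_diff poly_t_mult xy by this
  qed
  have e2: "poly_t Q' * y - poly_t Q = - ((poly_t Q * x - poly_t P) * y)"
    unfolding e1 by (simp only: left_diff_distrib mult.assoc left_inverse[OF y0] mult_1_right) simp
  have viy: "val_ge (inverse y) (int d)" and vy: "val_ge y (- int d)"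
    using suby subiy by (auto simp: val_ge_iff)
  have "val_ge (poly_t Q * inverse y) (1 - int r')"
    using val_ge_mult[OF Suc.prems(3) viy] unfolding r by simp
  then have v1: "val_ge (poly_t Q') (1 - int r')"
    unfolding e1 by (rule val_ge_diff[OF _ val_ge_mono[OF Suc.prems(4)]]) (simp_all add: r)
  have v2: "val_ge (poly_t Q' * y - poly_t Q) (int r' + 1)"
    unfolding e2 using val_ge_minus[OF val_ge_mult[OF Suc.prems(4) vy]] unfolding r by (simp add: add.commute)
  have "Q' = 0" using Suc.IH[OF irr r'_def v1 v2] .
  with v2 have "val_ge (poly_t (- Q)) (int r' + 1)" by (simp add: poly_t_minus)
  then have "- Q = 0" by (intro val_ge_1_poly_t) (rule val_ge_mono, assumption, simp)
  then show ?case by simp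
qed

lemma theta_of_nth: "theta_of s $$ n = seq_ext s (n - 1)"
  by (simp add: theta_of_def fls_X_times_conv_shift seq_ext_def)

text \<open>Row $r$ of the wall on the diagonal through $(0, k)$ is, up to reversing the rows, the Hankel
  determinant of order $r + 1$ of $\Theta t^k$; a kernel vector is a polynomial $Q$ of degree at
  most $r$ for which $Q \Theta t^k$ is too close to a polynomial.\<close>

lemma number_wall_neq_0:
  assumes "\<not> is_rational_t (theta_of s * fls_X_inv ^ k)"
    and "Suc r = (\<Sum>i=1..n. degree (cf_pq (theta_of s * fls_X_inv ^ k) i))"
  shows "number_wall s r (r + k) \<noteq> 0"
proof
  let ?x = "theta_of s * fls_X_inv ^ k"
  let ?M = "mat (Suc r) (Suc r) (\<lambda>(i, j). seq_ext s (int (r + k) - int i + int j))"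
  assume "number_wall s r (r + k) = 0"
  then have "det ?M = 0" by (simp add: number_wall_def)
  then obtain v where v: "v \<in> carrier_vec (Suc r)" "v \<noteq> 0\<^sub>v (Suc r)" "?M *\<^sub>v v = 0\<^sub>v (Suc r)"
    using det_0_iff_vec_prod_zero[of ?M "Suc r"] by auto
  define Q where "Q = (\<Sum>j\<le>r. Polynomial.monom (v $ j) j)"
  have cQ: "coeff Q j = (if j \<le> r then v $ j else 0)" for j
    by (simp add: Q_def coeff_sum)
  have dQ: "degree Q \<le> r" by (intro degree_le) (auto simp: cQ)
  have nth: "(poly_t Q * ?x) $$ n = (\<Sum>j\<le>r. seq_ext s (n - 1 + int k + int j) * v $ j)" for n
  proof -
    have "(poly_t Q * ?x) $$ n = (\<Sum>j\<le>degree Q. coeff Q j * seq_ext s (n - 1 + int k + int j))"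
      unfolding poly_t_mult_nth
      by (intro sum.cong) (auto simp: fls_X_inv_power_times_conv_shift theta_of_nth algebra_simps)
    also have "\<dots> = (\<Sum>j\<le>r. coeff Q j * seq_ext s (n - 1 + int k + int j))"
      using dQ by (intro sum.mono_neutral_left) (auto simp: coeff_eq_0)
    finally show ?thesis by (simp add: cQ mult.commute)
  qed
  have zero: "(poly_t Q * ?x) $$ n = 0" if n: "0 < n" "n < int (Suc r) + 1" for n
  proof -
    define i where "i = nat (int (Suc r) - n)"
    have i: "i < Suc r" "int i = int r + 1 - n" using n by (auto simp: i_def)
    have "(?M *\<^sub>v v) $ i = (\<Sum>j\<le>r. seq_ext s (int (r + k) - int i + int j) * v $ j)"
      using i v(1) by (auto simp: scalar_prod_def lessThan_Suc_atMost atLeast0LessThan)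
    also have "\<dots> = (poly_t Q * ?x) $$ n" unfolding nth i(2) by (simp add: algebra_simps)
    finally have "(?M *\<^sub>v v) $ i = (poly_t Q * ?x) $$ n" .
    then show ?thesis unfolding v(3) using i(1) by simp
  qed
  have "val_ge (poly_t Q * ?x - poly_t (int_part_t (poly_t Q * ?x))) (int (Suc r) + 1)"
    unfolding val_ge_def frac_part_nth using zero by auto
  moreover have "val_ge (poly_t Q) (1 - int (Suc r))"
    using val_ge_poly_t[of Q r] dQ by simp
  ultimately have "Q = 0"
    using best_approximation[OF assms(1), of "Suc r" n Q] assms(2) by simp
  then have "v $ j = 0" if "j < Suc r" for j using cQ[of j] that by simp
  then have "v = 0\<^sub>v (Suc r)" using v(1) by (intro eq_vecI) auto
  with v(2) show False by simp
qed

subsection \<open>Periodicity of quadratic irrationals\<close>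

lemma finite_val_ge_poly_t: "finite {P :: 'a::{field, finite} poly. val_ge (poly_t P) N}"
proof (rule finite_subset)
  show "{P :: 'a poly. val_ge (poly_t P) N} \<subseteq> Poly ` {xs. set xs \<subseteq> UNIV \<and> length xs \<le> Suc (nat (- N))}"
  proof
    fix P :: "'a poly"
    assume "P \<in> {P. val_ge (poly_t P) N}"
    then have "val_ge (poly_t P) (- int (nat (- N)))" by (auto intro: val_ge_mono)
    then have "length (coeffs P) \<le> Suc (nat (- N))"
      unfolding val_ge_poly_t by (cases "P = 0") (simp_all add: length_coeffs_degree)
    then have "coeffs P \<in> {xs. set xs \<subseteq> UNIV \<and> length xs \<le> Suc (nat (- N))}" by simp
    moreover have "P = Poly (coeffs P)" by simp
    ultimately show "P \<in> Poly ` {xs. set xs \<subseteq> UNIV \<and> length xs \<le> Suc (nat (- N))}" by (rule rev_image_eqI)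
  qed
  show "finite (Poly ` {xs :: 'a list. set xs \<subseteq> UNIV \<and> length xs \<le> Suc (nat (- N))})"
    by (intro finite_imageI finite_lists_length_le) simp
qed

lemma quadratic_lead_neq_0:
  assumes "\<not> is_rational_t x" and "(a, b, c) \<noteq> (0, 0, 0)"
    and "poly_t a * x\<^sup>2 + poly_t b * x + poly_t c = 0"
  shows "a \<noteq> 0"
proof
  assume "a = 0"
  with assms(3) have "x * poly_t b = poly_t (- c)"
    by (simp add: poly_t_minus mult.commute eq_neg_iff_add_eq_0)
  moreover from this \<open>a = 0\<close> assms(2) have "b \<noteq> 0" by (auto simp: poly_t_minus)
  ultimately show False using assms(1) is_rational_tI by blast
qed

text \<open>Passing from $x$ to $y = 1/(x - A)$ preserves \<open>2ax + b\<close> up to sign and yields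
  $|a'y| \<le> \max(|2ax + b|, |a|)$, so all coefficients stay bounded, in every characteristic.\<close>

definition bounded_quadratic :: "int \<Rightarrow> 'a::field fls \<Rightarrow> 'a poly \<Rightarrow> 'a poly \<Rightarrow> 'a poly \<Rightarrow> bool" where
  "bounded_quadratic N x a b c \<longleftrightarrow> a \<noteq> 0 \<and> poly_t a * x\<^sup>2 + poly_t b * x + poly_t c = 0 \<and>
     val_ge (2 * poly_t a * x + poly_t b) N \<and> val_ge (poly_t a) N"

lemma bounded_quadratic_step:
  assumes irr: "\<not> is_rational_t x" and bq: "bounded_quadratic N x a b c"
  shows "\<exists>a' b' c'. bounded_quadratic N (cf_rest x 1) a' b' c' \<and>
           val_ge (poly_t b') N \<and> val_ge (poly_t c') N"
proof -
  define B where "B = int_part_t x"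
  define \<delta> where "\<delta> = x - poly_t B"
  define y where "y = inverse \<delta>"
  define D where "D = 2 * poly_t a * x + poly_t b"
  define a' where "a' = a * B * B + b * B + c"
  define b' where "b' = a * B + a * B + b"
  have \<delta>0: "\<delta> \<noteq> 0" unfolding \<delta>_def using irrational_diff_neq_0[OF irr] .
  have v\<delta>: "val_ge \<delta> 1" unfolding \<delta>_def B_def by (rule val_ge_frac_part)
  have x: "x = poly_t B + \<delta>" by (simp add: \<delta>_def)
  have eq: "poly_t a * x\<^sup>2 + poly_t b * x + poly_t c = 0" and a0: "a \<noteq> 0"
    and vD: "val_ge D N" and va: "val_ge (poly_t a) N"
    using bq by (auto simp: bounded_quadratic_def D_def)
  have va\<delta>: "val_ge (poly_t a * \<delta>) N"
    using val_ge_mono[OF val_ge_mult[OF va v\<delta>]] by simp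
  have a'_eq: "poly_t a' = (poly_t a * \<delta> - D) * \<delta>"
  proof -
    have "u * w * w + v * w + t = (u * d - (2 * u * (w + d) + v)) * d"
      if "u * (w + d)\<^sup>2 + v * (w + d) + t = 0" for u v w t d :: "'a fls"
    proof -
      have "u * w * w + v * w + t = (u * d - (2 * u * (w + d) + v)) * d + (u * (w + d)\<^sup>2 + v * (w + d) + t)"
        by (simp add: algebra_simps power2_eq_square)
      with that show ?thesis by simp
    qed
    from this[OF eq[unfolded x]] show ?thesis
      unfolding a'_def D_def poly_t_add poly_t_mult x .
  qed
  have b'_eq: "poly_t b' = D - 2 * (poly_t a * \<delta>)"
  proof -
    have "u * w + u * w + v = 2 * u * (w + d) + v - 2 * (u * d)" for u v w d :: "'a fls"
      by (simp add: algebra_simps)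
    then show ?thesis unfolding b'_def D_def poly_t_add poly_t_mult x .
  qed
  have "\<delta> * y = 1" using \<delta>0 by (simp add: y_def)
  then have a'y: "poly_t a' * y = poly_t a * \<delta> - D"
    unfolding a'_eq mult.assoc by simp
  have "poly_t a' * y\<^sup>2 + poly_t b' * y + poly_t a = 0"
  proof -
    have "(u - D) * z + (D - 2 * u) * z + v = 0" if "u * z = v" for u v z :: "'a fls"
      using that by (simp add: algebra_simps)
    from this[of "poly_t a * \<delta>" y "poly_t a"] \<open>\<delta> * y = 1\<close> show ?thesis
      unfolding b'_eq power2_eq_square mult.assoc[symmetric] a'y by (simp add: mult.assoc)
  qed
  moreover from this have "a' \<noteq> 0"
    using quadratic_lead_neq_0[OF irrational_inverse_diff[OF irr], of a' b' a B] a0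
    by (simp add: y_def \<delta>_def)
  moreover have "val_ge (2 * poly_t a' * y + poly_t b') N"
  proof -
    have "2 * (u - D) + (D - 2 * u) = - D" for u :: "'a fls" by (simp add: algebra_simps)
    then have "2 * poly_t a' * y + poly_t b' = - D" unfolding b'_eq mult.assoc a'y .
    with vD show ?thesis by (simp add: val_ge_minus)
  qed
  moreover have "val_ge (poly_t a') N"
    unfolding a'_eq using val_ge_mult[OF val_ge_diff[OF va\<delta> vD] v\<delta>] by (rule val_ge_mono) simp
  moreover have "val_ge (poly_t b') N"
    unfolding b'_eq mult_2 by (intro val_ge_diff val_ge_add vD va\<delta>)
  moreover have "cf_rest x 1 = y" by (simp add: y_def \<delta>_def B_def)
  ultimately show ?thesis using va unfolding bounded_quadratic_def by blast
qed

theorem cf_eventually_periodic: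
  fixes x :: "'a::{field, finite} fls"
  assumes "quadratic_irrational_t x"
  shows "\<exists>l>0. \<exists>N. \<forall>i\<ge>N. cf_pq x (i + l) = cf_pq x i"
proof -
  have irr: "\<not> is_rational_t x" using assms by (simp add: quadratic_irrational_t_def)
  obtain a b c where abc: "(a, b, c) \<noteq> (0, 0, 0)" "poly_t a * x\<^sup>2 + poly_t b * x + poly_t c = 0"
    using assms by (auto simp: quadratic_irrational_t_def)
  define N where "N = min (fls_subdegree (2 * poly_t a * x + poly_t b)) (fls_subdegree (poly_t a))"
  have bq0: "bounded_quadratic N x a b c"
    using quadratic_lead_neq_0[OF irr abc] abc(2)
    by (auto simp: bounded_quadratic_def N_def val_ge_iff)
  define K where "K = {P :: 'a poly. val_ge (poly_t P) N}"
  define Roots where "Roots = (\<Union>(a, b, c)\<in>{(a, b, c). a \<in> K - {0} \<and> b \<in> K \<and> c \<in> K}.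
    {y. poly [:poly_t c, poly_t b, poly_t a:] y = 0})"
  have rest_Suc: "cf_rest (cf_rest x i) 1 = cf_rest x (Suc i)" for i
    by (simp only: Suc_eq_plus1 cf_rest_add)
  have bq: "\<exists>a b c. bounded_quadratic N (cf_rest x i) a b c" for i
  proof (induction i)
    case 0
    then show ?case using bq0 by auto
  next
    case (Suc i)
    then obtain a b c where "bounded_quadratic N (cf_rest x i) a b c" by blast
    from bounded_quadratic_step[OF irrational_cf_rest[OF irr] this] show ?case
      unfolding rest_Suc by blast
  qed
  have in_Roots: "cf_rest x (Suc i) \<in> Roots" for i
  proof -
    obtain a b c where "bounded_quadratic N (cf_rest x i) a b c" using bq by blast
    from bounded_quadratic_step[OF irrational_cf_rest[OF irr] this]
    obtain a' b' c' where s: "bounded_quadratic N (cf_rest x (Suc i)) a' b' c'"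
      "val_ge (poly_t b') N" "val_ge (poly_t c') N"
      unfolding rest_Suc by blast
    have "poly [:w, v, u:] y = u * y\<^sup>2 + v * y + w" for u v w y :: "'a fls"
      by (simp add: power2_eq_square algebra_simps)
    with s(1) have "poly [:poly_t c', poly_t b', poly_t a':] (cf_rest x (Suc i)) = 0"
      unfolding bounded_quadratic_def by (simp only:)
    with s show ?thesis unfolding Roots_def K_def bounded_quadratic_def by blast
  qed
  have finK: "finite K" unfolding K_def by (rule finite_val_ge_poly_t)
  have "finite {(a, b, c). a \<in> K - {0} \<and> b \<in> K \<and> c \<in> K}"
    by (rule finite_subset[of _ "K \<times> K \<times> K"]) (use finK in auto)
  then have "finite Roots"
    unfolding Roots_def by (rule finite_UN_I) (auto intro!: poly_roots_finite simp del: poly_pCons)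
  moreover have "range (\<lambda>i. cf_rest x (Suc i)) \<subseteq> Roots" using in_Roots by blast
  ultimately have "\<not> inj (\<lambda>i. cf_rest x (Suc i))"
    using finite_subset range_inj_infinite by blast
  then obtain i j where ij: "i < j" "cf_rest x (Suc i) = cf_rest x (Suc j)"
    unfolding inj_def by (metis nat_neq_iff)
  have "cf_pq x (k + (j - i)) = cf_pq x k" if "k \<ge> Suc i" for k
  proof -
    have "cf_pq x (Suc j + (k - Suc i)) = cf_pq x (Suc i + (k - Suc i))"
      unfolding cf_pq_add ij(2) ..
    moreover have "Suc j + (k - Suc i) = k + (j - i)" "Suc i + (k - Suc i) = k" using that ij by auto
    ultimately show ?thesis by simp
  qed
  with ij(1) show ?thesis by (intro exI[of _ "j - i"]) auto
qed

lemma quadratic_irrational_shift: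
  assumes "quadratic_irrational_t x"
  shows "quadratic_irrational_t (x * fls_X_inv ^ k)"
proof -
  let ?T = "Polynomial.monom 1 k :: 'a poly"
  have T0: "?T \<noteq> 0" by simp
  obtain a b c where irr: "\<not> is_rational_t x" and abc: "(a, b, c) \<noteq> (0, 0, 0)"
    "poly_t a * x\<^sup>2 + poly_t b * x + poly_t c = 0"
    using assms by (auto simp: quadratic_irrational_t_def)
  have "\<not> is_rational_t (x * fls_X_inv ^ k)"
  proof
    assume "is_rational_t (x * fls_X_inv ^ k)"
    then obtain P Q where "Q \<noteq> 0" "x * fls_X_inv ^ k * poly_t Q = poly_t P"
      by (auto simp: is_rational_t_def)
    then have "x * poly_t (?T * Q) = poly_t P" "?T * Q \<noteq> 0"
      using T0 by (simp_all only: poly_t_mult poly_t_monom mult.assoc mult_eq_0_iff de_Morgan_disj simp_thms)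
    with irr show False using is_rational_tI by blast
  qed
  moreover have "poly_t a * (x * fls_X_inv ^ k)\<^sup>2 + poly_t (b * ?T) * (x * fls_X_inv ^ k) + poly_t (c * ?T * ?T) = 0"
  proof -
    have "u * (x * T)\<^sup>2 + v * T * (x * T) + w * T * T = (u * x\<^sup>2 + v * x + w) * (T * T)" for u v w T :: "'a fls"
      by (simp add: algebra_simps power2_eq_square)
    then show ?thesis unfolding poly_t_mult poly_t_monom by (simp add: abc(2))
  qed
  moreover have "(a, b * ?T, c * ?T * ?T) \<noteq> (0, 0, 0)" using abc(1) T0 by auto
  ultimately show ?thesis unfolding quadratic_irrational_t_def by blast
qed

lemma cf_period_pos_and_periodic:
  fixes x :: "'a::{field, finite} fls"
  assumes "quadratic_irrational_t x"
  shows "cf_period x > 0"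
    and "i \<ge> cf_preperiod x \<Longrightarrow> cf_pq x (i + cf_period x) = cf_pq x i"
proof -
  let ?P = "\<lambda>l. l > 0 \<and> (\<exists>N. \<forall>i\<ge>N. cf_pq x (i + l) = cf_pq x i)"
  have "\<exists>l. ?P l" using cf_eventually_periodic[OF assms] .
  then have P: "?P (cf_period x)" unfolding cf_period_def by (rule LeastI_ex)
  then show "cf_period x > 0" ..
  from P have "\<exists>N. \<forall>i\<ge>N. cf_pq x (i + cf_period x) = cf_pq x i" ..
  then have "\<forall>i\<ge>cf_preperiod x. cf_pq x (i + cf_period x) = cf_pq x i"
    unfolding cf_preperiod_def by (rule LeastI_ex)
  then show "i \<ge> cf_preperiod x \<Longrightarrow> cf_pq x (i + cf_period x) = cf_pq x i" by simp
qed

lemma periodic_add_mult: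
  assumes "\<And>i. i \<ge> N \<Longrightarrow> d (i + l) = d i" and "i \<ge> (N :: nat)"
  shows "d (i + j * l) = d i"
proof (induction j)
  case (Suc j)
  have "d (i + Suc j * l) = d ((i + j * l) + l)" by (simp only: mult_Suc add.assoc add.commute[of l])
  also have "\<dots> = d (i + j * l)" using assms by (intro assms(1)) simp
  finally show ?case using Suc by simp
qed simp

lemma sum_periodic_blocks:
  fixes d :: "nat \<Rightarrow> nat"
  assumes "\<And>i. i \<ge> N \<Longrightarrow> d (i + l) = d i"
  shows "(\<Sum>i<N + j * l. d i) = (\<Sum>i<N. d i) + j * (\<Sum>i=N..<N + l. d i)"
proof (induction j)
  case (Suc j)
  have "(\<Sum>i<N + Suc j * l. d i) = (\<Sum>i<N + j * l. d i) + (\<Sum>i=N + j * l..<N + l + j * l. d i)"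
    using sum.atLeastLessThan_concat[of 0 "N + j * l" "N + l + j * l" d]
    by (simp add: lessThan_atLeast0 ac_simps)
  also have "(\<Sum>i=N + j * l..<N + l + j * l. d i) = (\<Sum>i=N..<N + l. d (i + j * l))"
    by (rule sum.shift_bounds_nat_ivl)
  also have "\<dots> = (\<Sum>i=N..<N + l. d i)"
  proof (rule sum.cong[OF refl])
    fix i assume "i \<in> {N..<N + l}"
    then have "N \<le> i" by simp
    with assms show "d (i + j * l) = d i" by (rule periodic_add_mult)
  qed
  finally show ?case using Suc by simp
qed simp

definition diagonal_support :: "(nat \<Rightarrow> 'a::comm_ring_1) \<Rightarrow> nat \<Rightarrow> nat \<Rightarrow> nat set" where
  "diagonal_support s k R = {r. r < R \<and> number_wall s r (r + k) \<noteq> 0}"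

lemma diagonal_support_lower_bound:
  fixes s :: "nat \<Rightarrow> 'a::{field, finite}" and k :: nat
  defines "x \<equiv> theta_of s * fls_X_inv ^ k"
  defines "S \<equiv> (\<Sum>i=cf_preperiod x..<cf_preperiod x + cf_period x. degree (cf_pq x i))"
  assumes "quadratic_irrational_t (theta_of s)"
  shows "0 < S"
    and "\<exists>C. \<forall>R. R * cf_period x \<le> S * (card (diagonal_support s k R) + C)"
proof -
  have qx: "quadratic_irrational_t x" unfolding x_def using quadratic_irrational_shift[OF assms(3)] .
  then have irr: "\<not> is_rational_t x" by (simp add: quadratic_irrational_t_def)
  define N where "N = cf_preperiod x"
  define l where "l = cf_period x"
  define d where "d i = degree (cf_pq x i)" for i
  define T where "T j = (\<Sum>i<j. d i)" for j
  have per: "d (i + l) = d i" if "i \<ge> N" for i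
    using cf_period_pos_and_periodic(2)[OF qx] that by (simp add: d_def l_def N_def)
  have l0: "l > 0" using cf_period_pos_and_periodic(1)[OF qx] by (simp add: l_def)
  have dpos: "d i > 0" if "i \<ge> 1" for i
    using fls_subdegree_cf_rest_Suc(2)[OF irr, of "i - 1"] that by (simp add: d_def)
  have dN: "d N > 0" using per[of N] dpos[of "N + l"] l0 by linarith
  have S: "S = (\<Sum>i=N..<N + l. d i)" by (simp add: S_def d_def N_def l_def)
  have "d N \<le> S" unfolding S using l0 by (intro member_le_sum) auto
  then show S0: "0 < S" using dN by simp
  have blocks: "T (N + j * l) = T N + j * S" for j
    unfolding T_def S by (rule sum_periodic_blocks) (rule per)
  define D where "D i = (\<Sum>i=1..i. d i)" for i
  have DSuc: "D (Suc i) = D i + d (Suc i)" for i by (simp add: D_def)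
  have mono: "strict_mono D"
    unfolding strict_mono_Suc_iff DSuc using dpos by simp
  have Dpos: "D i > 0" if "i \<ge> 1" for i
    using strict_mono_less[OF mono, of 0 i] that by linarith
  have DT: "D i \<le> T (Suc i)" for i
    unfolding D_def T_def by (rule sum_mono2) auto
  have "R * l \<le> S * (card (diagonal_support s k R) + (T N * l + l + 1))" for R
  proof (cases "R < T N")
    case True
    then have "R * l \<le> 1 * (T N * l)" by simp
    also have "\<dots> \<le> S * (card (diagonal_support s k R) + (T N * l + l + 1))"
      using S0 by (intro mult_mono) auto
    finally show ?thesis .
  next
    case False
    define j where "j = (R - T N) div S"
    have "j * S \<le> R - T N" unfolding j_def by (rule div_times_less_eq_dividend)
    moreover have "R - T N < S + j * S" unfolding j_def using S0 by (rule dividend_less_div_times)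
    ultimately have j: "T N + j * S \<le> R" "R < T N + (j + 1) * S"
      using False by (simp_all add: not_less)
    have "(\<lambda>i. D i - 1) ` {1..<N + j * l} \<subseteq> diagonal_support s k R"
    proof (rule image_subsetI)
      fix i assume i: "i \<in> {1..<N + j * l}"
      have "D i \<le> T (Suc i)" by (rule DT)
      also have "\<dots> \<le> T (N + j * l)" unfolding T_def using i by (intro sum_mono2) auto
      also have "\<dots> \<le> R" using blocks j by simp
      finally have "D i - 1 < R" using Dpos[of i] i by auto
      moreover have "number_wall s (D i - 1) (D i - 1 + k) \<noteq> 0"
      proof (rule number_wall_neq_0)
        show "\<not> is_rational_t (theta_of s * fls_X_inv ^ k)" using irr unfolding x_def .
        have "Suc (D i - 1) = D i" using Dpos[of i] i by simp
        then show "Suc (D i - 1) = (\<Sum>i=1..i. degree (cf_pq (theta_of s * fls_X_inv ^ k) i))"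
          unfolding D_def d_def x_def .
      qed
      ultimately show "D i - 1 \<in> diagonal_support s k R" by (simp add: diagonal_support_def)
    qed
    moreover have "inj_on (\<lambda>i. D i - 1) {1..<N + j * l}"
    proof (rule inj_onI)
      fix i i' assume "i \<in> {1..<N + j * l}" "i' \<in> {1..<N + j * l}" "D i - 1 = D i' - 1"
      then have "D i = D i'" using Dpos[of i] Dpos[of i'] by auto
      then show "i = i'" using strict_mono_eq[OF mono] by blast
    qed
    moreover have "finite (diagonal_support s k R)" by (simp add: diagonal_support_def)
    ultimately have "card {1..<N + j * l} \<le> card (diagonal_support s k R)"
      by (meson card_inj_on_le)
    then have "j * l \<le> card (diagonal_support s k R) + 1" by simp
    then have "S * (j * l + l) \<le> S * (card (diagonal_support s k R) + 1 + l)"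
      by (intro mult_le_mono add_le_mono) simp_all
    moreover have "R * l \<le> (T N + (j + 1) * S) * l" using j(2) by (intro mult_le_mono) simp_all
    then have "R * l \<le> 1 * (T N * l) + S * (j * l + l)" by (simp add: algebra_simps)
    moreover have "1 * (T N * l) \<le> S * (T N * l)" using S0 by (intro mult_le_mono) simp_all
    ultimately have "R * l \<le> S * (T N * l) + S * (card (diagonal_support s k R) + 1 + l)" by linarith
    then show ?thesis by (simp add: distrib_left ac_simps)
  qed
  then show "\<exists>C. \<forall>R. R * cf_period x \<le> S * (card (diagonal_support s k R) + C)"
    unfolding l_def by blast
qed

lemma e_kn_le_imp_diagonal_support:
  fixes s :: "nat \<Rightarrow> 'a::{field, finite}"
  assumes "quadratic_irrational_t (theta_of s)" and "0 < \<epsilon>" and "e_kn (theta_of s) k n \<le> 1 - \<epsilon>"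
  shows "\<exists>C. \<forall>R. \<epsilon> * real R \<le> real n * (real (card (diagonal_support s k R)) + C)"
proof -
  define x where "x = theta_of s * fls_X_inv ^ k"
  define l where "l = cf_period x"
  define J where "J = {cf_preperiod x..<cf_preperiod x + l}"
  define S where "S = (\<Sum>i\<in>J. degree (cf_pq x i))"
  have S0: "0 < S" and "\<exists>C. \<forall>R. R * l \<le> S * (card (diagonal_support s k R) + C)"
    using diagonal_support_lower_bound[OF assms(1), of k] by (auto simp: x_def l_def S_def J_def)
  then obtain C where C: "R * l \<le> S * (card (diagonal_support s k R) + C)" for R by blast
  have "(\<Sum>i\<in>J. real (degree (cf_pq x i)) - real n) \<le> (\<Sum>i\<in>J. max (real (degree (cf_pq x i)) - real n) 0)"
    by (intro sum_mono) simp
  then have "real S - real n * real l \<le> (\<Sum>i\<in>J. max (real (degree (cf_pq x i)) - real n) 0)"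
    by (simp add: sum_subtractf S_def J_def mult.commute)
  moreover have "(\<Sum>i\<in>J. max (real (degree (cf_pq x i)) - real n) 0) / real S \<le> 1 - \<epsilon>"
    using assms(3) by (simp add: e_kn_def Let_def x_def l_def S_def J_def)
  then have "(\<Sum>i\<in>J. max (real (degree (cf_pq x i)) - real n) 0) \<le> (1 - \<epsilon>) * real S"
    using S0 by (simp add: pos_divide_le_eq)
  ultimately have \<epsilon>S: "\<epsilon> * real S \<le> real n * real l" by (simp add: algebra_simps)
  have "\<epsilon> * real R \<le> real n * (real (card (diagonal_support s k R)) + real C)" for R
  proof -
    have "(\<epsilon> * real R) * real S = real R * (\<epsilon> * real S)" by simp
    also have "\<dots> \<le> real R * (real n * real l)" using \<epsilon>S by (intro mult_left_mono) auto
    also have "\<dots> = real n * real (R * l)" by simp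
    also have "\<dots> \<le> real n * real (S * (card (diagonal_support s k R) + C))"
      using C[of R] by (intro mult_left_mono of_nat_mono) auto
    also have "\<dots> = (real n * (real (card (diagonal_support s k R)) + real C)) * real S"
      by simp
    finally show ?thesis using S0 by (simp add: mult_le_cancel_right)
  qed
  then show ?thesis by blast
qed

subsection \<open>Density of zeros in the morphic array\<close>

lemma morph_pow_Suc_prolongable:
  assumes "prolongable p \<zeta> A" and "i < p ^ k" and "j < p ^ k"
  shows "morph_pow p \<zeta> (Suc k) A i j = morph_pow p \<zeta> k A i j"
  using assms(2,3)
proof (induction k arbitrary: i j)
  case 0
  then show ?case using assms(1) by (simp add: prolongable_def)
next
  case (Suc k)
  then have "i div p < p ^ k" "j div p < p ^ k" by (auto intro: less_mult_imp_div_less simp: mult.commute)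
  then have "morph_pow p \<zeta> (Suc k) A (i div p) (j div p) = morph_pow p \<zeta> k A (i div p) (j div p)"
    by (rule Suc.IH)
  then show ?case
    by (subst (1 2) morph_pow.simps(2)) (simp only:)
qed

lemma morph_inf_eq_morph_pow:
  assumes "prolongable p \<zeta> A" and "p \<ge> 2" and "i < p ^ k" and "j < p ^ k"
  shows "morph_inf p \<zeta> A i j = morph_pow p \<zeta> k A i j"
proof -
  have stable: "morph_pow p \<zeta> (k + d) A i j = morph_pow p \<zeta> k A i j" if "i < p ^ k" "j < p ^ k" for k d
  proof (induction d)
    case (Suc d)
    have "p ^ k \<le> p ^ (k + d)" using assms(2) by (intro power_increasing) auto
    then have "morph_pow p \<zeta> (Suc (k + d)) A i j = morph_pow p \<zeta> (k + d) A i j"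
      using that by (intro morph_pow_Suc_prolongable[OF assms(1)]) auto
    with Suc show ?case by (simp only: add_Suc_right)
  qed simp
  define k' where "k' = Suc (max i j)"
  have "max i j < 2 ^ k'" unfolding k'_def using less_exp[of "Suc (max i j)"] by linarith
  also have "2 ^ k' \<le> p ^ k'" using assms(2) by (rule power_mono) simp
  finally have "i < p ^ k'" "j < p ^ k'" by auto
  from stable[OF this, of k] stable[OF assms(3,4), of k'] show ?thesis
    unfolding morph_inf_def k'_def by (simp only: add.commute)
qed

lemma less_power_witness:
  assumes "p \<ge> (2 :: nat)"
  shows "\<exists>k. i < p ^ k \<and> j < p ^ k"
proof (intro exI)
  have "max i j < 2 ^ max i j" by (rule less_exp)
  also have "2 ^ max i j \<le> p ^ max i j" using assms by (rule power_mono) simp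
  finally show "i < p ^ max i j \<and> j < p ^ max i j" by simp
qed

lemma morph_inf_block:
  assumes "prolongable p \<zeta> A" and "p \<ge> 2"
  shows "morph_inf p \<zeta> A i j =
    morph_pow p \<zeta> K (morph_inf p \<zeta> A (i div p ^ K) (j div p ^ K)) (i mod p ^ K) (j mod p ^ K)"
proof (induction K arbitrary: i j)
  case (Suc K)
  obtain k where k: "i < p ^ k" "j < p ^ k" using less_power_witness[OF assms(2)] by blast
  then have k': "i < p ^ Suc k" "j < p ^ Suc k"
    using assms(2) by (auto intro: less_le_trans[OF _ power_increasing[of k "Suc k" p]] simp del: power_Suc)
  have k'': "i div p < p ^ k" "j div p < p ^ k" using k by (meson div_le_dividend le_less_trans)+
  have "morph_inf p \<zeta> A i j = \<zeta> (morph_inf p \<zeta> A (i div p) (j div p)) (i mod p) (j mod p)"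
    unfolding morph_inf_eq_morph_pow[OF assms k'] morph_inf_eq_morph_pow[OF assms k''] by simp
  also have "\<dots> = morph_pow p \<zeta> (Suc K) (morph_inf p \<zeta> A (i div p ^ Suc K) (j div p ^ Suc K))
      (i mod p ^ Suc K) (j mod p ^ Suc K)"
    using assms(2) by (subst Suc.IH) (simp add: div_mult2_eq mod_mult2_eq)
  finally show ?case .
qed simp

definition nonzero_count :: "nat \<Rightarrow> ('x \<Rightarrow> nat \<Rightarrow> nat \<Rightarrow> 'x) \<Rightarrow> 'x \<Rightarrow> nat \<Rightarrow> 'x \<Rightarrow> nat" where
  "nonzero_count p \<zeta> z K B = card {(i, j). i < p ^ K \<and> j < p ^ K \<and> morph_pow p \<zeta> K B i j \<noteq> z}"

lemma finite_square: "finite {(i, j). i < (n :: nat) \<and> j < n \<and> P i j}"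
  by (rule finite_subset[of _ "{..<n} \<times> {..<n}"]) auto

lemma count_letter_add_nonzero_count:
  "count_letter p \<zeta> K B z + nonzero_count p \<zeta> z K B = p ^ (2 * K)"
proof -
  have "count_letter p \<zeta> K B z + nonzero_count p \<zeta> z K B =
      card ({(i, j). i < p ^ K \<and> j < p ^ K \<and> morph_pow p \<zeta> K B i j = z}
        \<union> {(i, j). i < p ^ K \<and> j < p ^ K \<and> morph_pow p \<zeta> K B i j \<noteq> z})"
    unfolding count_letter_def nonzero_count_def
    by (intro card_Un_disjoint[symmetric] finite_square) auto
  also have "\<dots> = card ({..<p ^ K} \<times> {..<p ^ K})"
    by (intro arg_cong[of _ _ card]) auto
  finally show ?thesis by (simp add: mult_2 power_add)
qed

lemma nonzero_count_le:
  assumes "prolongable p \<zeta> A" and "p \<ge> 2" and "a < p ^ J" and "b < p ^ J"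
  shows "nonzero_count p \<zeta> z K (morph_inf p \<zeta> A a b) \<le> nonzero_count p \<zeta> z (K + J) A"
  unfolding nonzero_count_def
proof (rule card_inj_on_le)
  let ?f = "\<lambda>(i, j). (a * p ^ K + i, b * p ^ K + j)"
  let ?S = "{(i, j). i < p ^ K \<and> j < p ^ K \<and> morph_pow p \<zeta> K (morph_inf p \<zeta> A a b) i j \<noteq> z}"
  show "inj_on ?f ?S" by (auto simp: inj_on_def)
  show "finite {(i, j). i < p ^ (K + J) \<and> j < p ^ (K + J) \<and> morph_pow p \<zeta> (K + J) A i j \<noteq> z}"
    by (rule finite_square)
  have bound: "c * p ^ K + i < p ^ (K + J)" if "c < p ^ J" "i < p ^ K" for c i
  proof -
    have "c * p ^ K + i < Suc c * p ^ K" using that by simp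
    also have "\<dots> \<le> p ^ J * p ^ K" using that by (intro mult_le_mono) auto
    finally show ?thesis by (simp add: power_add mult.commute)
  qed
  have "morph_pow p \<zeta> (K + J) A (a * p ^ K + i) (b * p ^ K + j)
      = morph_pow p \<zeta> K (morph_inf p \<zeta> A a b) i j" if "i < p ^ K" "j < p ^ K" for i j
  proof -
    have "(a * p ^ K + i) div p ^ K = a" "(b * p ^ K + j) div p ^ K = b"
      "(a * p ^ K + i) mod p ^ K = i" "(b * p ^ K + j) mod p ^ K = j"
      using that assms(2) by simp_all
    then show ?thesis
      using morph_inf_block[OF assms(1,2), of "a * p ^ K + i" "b * p ^ K + j" K]
        morph_inf_eq_morph_pow[OF assms(1,2) bound[OF assms(3) that(1)] bound[OF assms(4) that(2)]]
      by simp
  qed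
  then show "?f ` ?S \<subseteq> {(i, j). i < p ^ (K + J) \<and> j < p ^ (K + J) \<and> morph_pow p \<zeta> (K + J) A i j \<noteq> z}"
    using bound assms(3,4) by auto
qed

text \<open>Every letter of \<open>\<zeta>\<^sup>\<infinity>(A)\<close> already occurs in some fixed \<open>\<zeta>\<^sup>J(A)\<close>, so its images occupy a
  fixed positive proportion of the images of \<open>A\<close>.\<close>

lemma nonzero_count_uniformly_small:
  fixes \<zeta> :: "'x::finite \<Rightarrow> nat \<Rightarrow> nat \<Rightarrow> 'x"
  assumes prol: "prolongable p \<zeta> A" and p: "p \<ge> 2" and \<eta>: "0 < (\<eta> :: real)"
    and lim: "(\<lambda>k. real (count_letter p \<zeta> k A z) / real p ^ (2 * k)) \<longlonglongrightarrow> 1"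
  shows "\<exists>K. \<forall>a b. real (nonzero_count p \<zeta> z K (morph_inf p \<zeta> A a b)) \<le> \<eta> * real p ^ (2 * K)"
proof -
  let ?X = "morph_inf p \<zeta> A"
  define occ where "occ B J \<longleftrightarrow> (\<exists>a b. a < p ^ J \<and> b < p ^ J \<and> ?X a b = B)" for B J
  define J where "J = (\<Sum>B\<in>UNIV. LEAST J. occ B J)"
  have occ: "occ (?X a b) J" for a b
  proof -
    have "\<exists>J. occ (?X a b) J" using less_power_witness[OF p, of a b] by (auto simp: occ_def)
    then have "occ (?X a b) (LEAST J. occ (?X a b) J)" by (rule LeastI_ex)
    moreover have "(LEAST J. occ (?X a b) J) \<le> J"
      unfolding J_def by (rule member_le_sum) auto
    then have "p ^ (LEAST J. occ (?X a b) J) \<le> p ^ J" using p by (intro power_increasing) auto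
    ultimately show ?thesis unfolding occ_def by (meson less_le_trans)
  qed
  have p0: "real p > 0" using p by simp
  have "0 < \<eta> / real p ^ (2 * J)" using \<eta> p0 by simp
  from LIMSEQ_D[OF lim this] obtain k0 where
    k0: "\<bar>real (count_letter p \<zeta> k A z) / real p ^ (2 * k) - 1\<bar> < \<eta> / real p ^ (2 * J)" if "k \<ge> k0" for k
    by auto
  define k where "k = k0 + J"
  have pk: "real p ^ (2 * k) > 0" using p0 by simp
  have pe: "real p ^ (2 * k) = real p ^ (2 * k0) * real p ^ (2 * J)"
    by (simp add: k_def distrib_left power_add)
  have "real (count_letter p \<zeta> k A z) + real (nonzero_count p \<zeta> z k A) = real p ^ (2 * k)"
    by (simp only: count_letter_add_nonzero_count flip: of_nat_add of_nat_power)
  then have "real (nonzero_count p \<zeta> z k A)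
      = (1 - real (count_letter p \<zeta> k A z) / real p ^ (2 * k)) * real p ^ (2 * k)"
    using pk by (simp add: left_diff_distrib)
  also have "\<dots> \<le> (\<eta> / real p ^ (2 * J)) * real p ^ (2 * k)"
    using k0[of k] pk by (intro mult_right_mono) (auto simp: k_def)
  also have "\<dots> = \<eta> * real p ^ (2 * k0)" unfolding pe using p0 by simp
  finally have small: "real (nonzero_count p \<zeta> z k A) \<le> \<eta> * real p ^ (2 * k0)" .
  show ?thesis
  proof (intro exI allI)
    fix a b
    obtain a' b' where "a' < p ^ J" "b' < p ^ J" "?X a' b' = ?X a b"
      using occ[of a b] by (auto simp: occ_def)
    then have "nonzero_count p \<zeta> z k0 (?X a b) \<le> nonzero_count p \<zeta> z k A"
      using nonzero_count_le[OF prol p, of a' J b' z k0] by (simp add: k_def)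
    with small show "real (nonzero_count p \<zeta> z k0 (?X a b)) \<le> \<eta> * real p ^ (2 * k0)" by linarith
  qed
qed

lemma wall_block_support_card_le:
  fixes s :: "nat \<Rightarrow> 'a::comm_ring_1" and K :: nat
  assumes prol: "prolongable p \<zeta> A" and p: "p \<ge> 2" and m: "m \<ge> 1"
    and zero: "\<forall>i j. i < m \<and> j < m \<longrightarrow> \<xi> z i j = 0"
    and profile: "wall_profile s = apply_coding m \<xi> (morph_inf p \<zeta> A)"
  defines "E \<equiv> \<lambda>a b. {(r, c). r div (m * p ^ K) = a \<and> c div (m * p ^ K) = b \<and> number_wall s r c \<noteq> 0}"
  shows "finite (E a b)"
    and "card (E a b) \<le> m ^ 2 * nonzero_count p \<zeta> z K (morph_inf p \<zeta> A a b)"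
proof -
  let ?S = "{(i, j). i < p ^ K \<and> j < p ^ K \<and> morph_pow p \<zeta> K (morph_inf p \<zeta> A a b) i j \<noteq> z}"
  let ?f = "\<lambda>((u, v), (i, j)). ((a * p ^ K + i) * m + u, (b * p ^ K + j) * m + v)"
  have sub: "E a b \<subseteq> ?f ` (({..<m} \<times> {..<m}) \<times> ?S)"
  proof
    fix e assume "e \<in> E a b"
    then obtain r c where e: "e = (r, c)" and rc: "r div (m * p ^ K) = a" "c div (m * p ^ K) = b"
      and W: "number_wall s r c \<noteq> 0" by (auto simp: E_def)
    have "apply_coding m \<xi> (morph_inf p \<zeta> A) r c \<noteq> 0"
      unfolding profile[symmetric] using W by (simp add: wall_profile_def)
    then have X: "morph_inf p \<zeta> A (r div m) (c div m) \<noteq> z"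
      using zero m by (auto simp: apply_coding_def)
    have rc': "r div m div p ^ K = a" "c div m div p ^ K = b"
      using rc by (simp_all add: div_mult2_eq)
    define i where "i = r div m mod p ^ K"
    define j where "j = c div m mod p ^ K"
    have "(i, j) \<in> ?S"
      using X p unfolding morph_inf_block[OF prol p, of "r div m" "c div m" K] rc' i_def j_def by simp
    moreover have "r div m = a * p ^ K + i" "c div m = b * p ^ K + j"
      unfolding i_def j_def rc'[symmetric] by (simp_all only: div_mult_mod_eq)
    then have "r = (a * p ^ K + i) * m + r mod m" "c = (b * p ^ K + j) * m + c mod m"
      by (metis div_mult_mod_eq)+
    then have "e = ?f ((r mod m, c mod m), (i, j))" by (simp add: e)
    ultimately show "e \<in> ?f ` (({..<m} \<times> {..<m}) \<times> ?S)"
      using m by (intro rev_image_eqI[of "((r mod m, c mod m), (i, j))"]) auto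
  qed
  have fin: "finite (({..<m} \<times> {..<m}) \<times> ?S)" by (intro finite_cartesian_product finite_square) auto
  show "finite (E a b)" using finite_subset[OF sub] fin by blast
  have "card (E a b) \<le> card (({..<m} \<times> {..<m}) \<times> ?S)"
    by (rule surj_card_le[OF fin sub])
  then show "card (E a b) \<le> m ^ 2 * nonzero_count p \<zeta> z K (morph_inf p \<zeta> A a b)"
    by (simp add: nonzero_count_def power2_eq_square card_cartesian_product)
qed

text \<open>The part of the wall consisting of the diagonals \<open>k < q M\<close> and the first \<open>M L\<close> rows meets at
  most \<open>L (q + 1)\<close> of the \<open>M \<times> M\<close> blocks.\<close>

lemma strip_support_card_le:
  fixes s :: "nat \<Rightarrow> 'a::comm_ring_1" and \<eta> :: real
  assumes prol: "prolongable p \<zeta> A" and p: "p \<ge> 2" and m: "m \<ge> 1"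
    and zero: "\<forall>i j. i < m \<and> j < m \<longrightarrow> \<xi> z i j = 0"
    and profile: "wall_profile s = apply_coding m \<xi> (morph_inf p \<zeta> A)"
    and small: "\<forall>a b. real (nonzero_count p \<zeta> z K (morph_inf p \<zeta> A a b)) \<le> \<eta> * real p ^ (2 * K)"
  defines "M \<equiv> m * p ^ K"
  shows "(\<Sum>k<q * M. real (card (diagonal_support s k (M * L)))) \<le> real L * real (q + 1) * \<eta> * (real M)\<^sup>2"
proof -
  define E where "E a b = {(r, c). r div M = a \<and> c div M = b \<and> number_wall s r c \<noteq> 0}" for a b
  have M0: "M > 0" using m p by (simp add: M_def)
  have finE: "finite (E a b)" and cardE: "real (card (E a b)) \<le> \<eta> * (real M)\<^sup>2" for a b
  proof -
    note block = wall_block_support_card_le[OF prol p m zero profile, where K = K and a = a and b = b]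
    show "finite (E a b)" using block(1) by (simp add: E_def M_def)
    have "card (E a b) \<le> m ^ 2 * nonzero_count p \<zeta> z K (morph_inf p \<zeta> A a b)"
      using block(2) by (simp add: E_def M_def)
    then have "real (card (E a b)) \<le> real (m ^ 2 * nonzero_count p \<zeta> z K (morph_inf p \<zeta> A a b))"
      by (simp only: of_nat_le_iff)
    also have "\<dots> = (real m)\<^sup>2 * real (nonzero_count p \<zeta> z K (morph_inf p \<zeta> A a b))" by simp
    also have "\<dots> \<le> (real m)\<^sup>2 * (\<eta> * real p ^ (2 * K))"
      using small by (intro mult_left_mono) auto
    also have "\<dots> = \<eta> * (real M)\<^sup>2"
      by (simp add: M_def power_mult_distrib mult.commute[of 2] power_mult)
    finally show "real (card (E a b)) \<le> \<eta> * (real M)\<^sup>2" .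
  qed
  let ?I = "{..<L} \<times> {..q}"
  let ?U = "\<Union>(a, t)\<in>?I. E a (a + t)"
  have "(\<Sum>k<q * M. card (diagonal_support s k (M * L)))
      = card (SIGMA k:{..<q * M}. diagonal_support s k (M * L))"
    by (intro card_SigmaI[symmetric]) (auto simp: diagonal_support_def)
  also have "\<dots> \<le> card ?U"
  proof (rule card_inj_on_le)
    show "inj_on (\<lambda>(k, r). (r, r + k)) (SIGMA k:{..<q * M}. diagonal_support s k (M * L))"
      by (auto simp: inj_on_def)
    show "finite ?U" using finE by auto
    show "(\<lambda>(k, r). (r, r + k)) ` (SIGMA k:{..<q * M}. diagonal_support s k (M * L)) \<subseteq> ?U"
    proof
      fix e assume "e \<in> (\<lambda>(k, r). (r, r + k)) ` (SIGMA k:{..<q * M}. diagonal_support s k (M * L))"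
      then obtain k r where e: "e = (r, r + k)" and k: "k \<in> {..<q * M}"
        and r: "r \<in> diagonal_support s k (M * L)" by auto
      define a where "a = r div M"
      define t where "t = (r + k) div M - r div M"
      have "r div M \<le> (r + k) div M" by (rule div_le_mono) simp
      then have at: "(r + k) div M = a + t" by (simp add: a_def t_def)
      have "(r + k) div M \<le> (r + q * M) div M" using k by (intro div_le_mono) auto
      also have "\<dots> = a + q" using M0 by (simp add: a_def)
      finally have "t \<le> q" using at by simp
      moreover have "a < L" using r M0 by (simp add: a_def diagonal_support_def less_mult_imp_div_less mult.commute)
      moreover have "(r, r + k) \<in> E a (a + t)"
        using r at by (simp add: E_def a_def diagonal_support_def)
      ultimately show "e \<in> ?U" unfolding e by blast
    qed
  qed
  also have "card ?U \<le> (\<Sum>(a, t)\<in>?I. card (E a (a + t)))"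
    using card_UN_le[of ?I "\<lambda>(a, t). E a (a + t)"] by (simp add: case_prod_unfold)
  finally have "real (\<Sum>k<q * M. card (diagonal_support s k (M * L)))
      \<le> real (\<Sum>(a, t)\<in>?I. card (E a (a + t)))" by (simp only: of_nat_le_iff)
  also have "\<dots> = (\<Sum>(a, t)\<in>?I. real (card (E a (a + t))))"
    by (simp add: case_prod_unfold)
  also have "\<dots> \<le> (\<Sum>(a, t)\<in>?I. \<eta> * (real M)\<^sup>2)"
    by (intro sum_mono) (auto intro: cardE)
  also have "\<dots> = real L * real (q + 1) * \<eta> * (real M)\<^sup>2"
    by (simp add: case_prod_unfold card_cartesian_product distrib_left)
  finally show ?thesis by simp
qed

lemma slope_le_of_affine_bound:
  fixes a b c :: real
  assumes "\<And>L :: nat. a * real L \<le> b * real L + c"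
  shows "a \<le> b"
proof (rule ccontr)
  assume "\<not> a \<le> b"
  then obtain L :: nat where "c < real L * (a - b)" using reals_Archimedean3[of "a - b"] by auto
  with assms[of L] show False by (simp add: algebra_simps)
qed

theorem theorem7p11:
  fixes s :: "nat \<Rightarrow> 'a::{field, finite}"
    and p m :: nat
    and \<zeta> :: "'x::finite \<Rightarrow> nat \<Rightarrow> nat \<Rightarrow> 'x"
    and \<xi> :: "'x \<Rightarrow> nat \<Rightarrow> nat \<Rightarrow> nat"
    and z A :: 'x
  assumes p_pp: "\<exists>q r. prime q \<and> r > 0 \<and> p = q ^ r"
    and card_field: "card (UNIV :: 'a set) = p"
    and m_pos: "m \<ge> 1"
    and quad: "quadratic_irrational_t (theta_of s)"
    and zA: "z \<noteq> A"
    and prol: "prolongable p \<zeta> A"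
    and xi_bin: "\<forall>x i j. i < m \<and> j < m \<longrightarrow> \<xi> x i j \<in> {0, 1}"
    and xi_zero: "\<forall>i j. i < m \<and> j < m \<longrightarrow> \<xi> z i j = 0"
    and zeta_zero: "\<forall>i j. i < p \<and> j < p \<longrightarrow> \<zeta> z i j = z"
    and profile: "wall_profile s = apply_coding m \<xi> (morph_inf p \<zeta> A)"
    and dens0: "(\<lambda>k. real (count_letter p \<zeta> k A z) / real p ^ (2 * k)) \<longlonglongrightarrow> 1"
  shows "\<forall>\<epsilon>>0. \<exists>d :: nat \<Rightarrow> real.
           (\<forall>\<^sub>F n in sequentially.
              has_nat_density {k. k \<ge> 1 \<and> e_kn (theta_of s) k n > 1 - \<epsilon>} (d n))
           \<and> d \<longlonglongrightarrow> 1"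
proof (intro allI impI)
  fix \<epsilon> :: real assume \<epsilon>: "\<epsilon> > 0"
  have p2: "p \<ge> 2"
  proof -
    have "card {0, 1 :: 'a} \<le> card (UNIV :: 'a set)" by (intro card_mono) auto
    then show ?thesis using card_field by simp
  qed
  have "has_nat_density {k. k \<ge> 1 \<and> e_kn (theta_of s) k n > 1 - \<epsilon>} 1" for n
  proof -
    define Good where "Good = {k. k \<ge> 1 \<and> e_kn (theta_of s) k n > 1 - \<epsilon>}"
    define Bad where "Bad N = {1..N} - Good" for N
    have bad: "\<exists>M>0. \<forall>N\<ge>M. \<epsilon> * real (card (Bad N)) \<le> 3 * real n * \<eta> * real N"
      if \<eta>: "\<eta> > 0" for \<eta> :: real
    proof -
      obtain K where K: "\<forall>a b. real (nonzero_count p \<zeta> z K (morph_inf p \<zeta> A a b)) \<le> \<eta> * real p ^ (2 * K)"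
        using nonzero_count_uniformly_small[OF prol p2 \<eta> dens0] by blast
      define M where "M = m * p ^ K"
      have M0: "M > 0" using m_pos p2 by (simp add: M_def)
      have "\<epsilon> * real (card (Bad N)) \<le> 3 * real n * \<eta> * real N" if N: "N \<ge> M" for N
      proof -
        define q where "q = N div M + 1"
        have Nq: "N < q * M" using dividend_less_div_times[OF M0, of N] by (simp add: q_def)
        have "q * M \<le> N + M" using div_times_less_eq_dividend[of N M] by (simp add: q_def)
        then have "(q + 1) * M \<le> 3 * N" using N by simp
        then have q: "real (q + 1) * real M \<le> 3 * real N"
          by (metis of_nat_le_iff of_nat_mult of_nat_numeral)
        have "\<forall>k\<in>Bad N. \<exists>C. \<forall>R. \<epsilon> * real R \<le> real n * (real (card (diagonal_support s k R)) + C)"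
        proof
          fix k assume "k \<in> Bad N"
          then have "e_kn (theta_of s) k n \<le> 1 - \<epsilon>" by (auto simp: Bad_def Good_def)
          then show "\<exists>C. \<forall>R. \<epsilon> * real R \<le> real n * (real (card (diagonal_support s k R)) + C)"
            by (rule e_kn_le_imp_diagonal_support[OF quad \<epsilon>])
        qed
        then obtain C where
          C: "\<epsilon> * real R \<le> real n * (real (card (diagonal_support s k R)) + C k)" if "k \<in> Bad N" for k R
          by metis
        define C' where "C' = (\<Sum>k\<in>Bad N. C k)"
        have "\<epsilon> * real (card (Bad N)) * real M \<le> real n * real (q + 1) * \<eta> * real M * real M"
        proof (rule slope_le_of_affine_bound)
          fix L :: nat
          have "(\<Sum>k\<in>Bad N. real (card (diagonal_support s k (M * L))))
              \<le> (\<Sum>k<q * M. real (card (diagonal_support s k (M * L))))"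
            using Nq by (intro sum_mono2) (auto simp: Bad_def)
          also have "\<dots> \<le> real L * real (q + 1) * \<eta> * (real M)\<^sup>2"
            unfolding M_def by (rule strip_support_card_le[OF prol p2 m_pos xi_zero profile K])
          finally have strip: "(\<Sum>k\<in>Bad N. real (card (diagonal_support s k (M * L))))
              \<le> real L * real (q + 1) * \<eta> * (real M)\<^sup>2" .
          have "\<epsilon> * real (card (Bad N)) * real M * real L = (\<Sum>k\<in>Bad N. \<epsilon> * real (M * L))" by simp
          also have "\<dots> \<le> (\<Sum>k\<in>Bad N. real n * (real (card (diagonal_support s k (M * L))) + C k))"
            by (intro sum_mono C)
          also have "\<dots> = real n * ((\<Sum>k\<in>Bad N. real (card (diagonal_support s k (M * L)))) + C')"
            by (simp add: C'_def sum.distrib flip: sum_distrib_left)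
          also have "\<dots> \<le> real n * (real L * real (q + 1) * \<eta> * (real M)\<^sup>2 + C')"
            using strip by (intro mult_left_mono add_right_mono) simp_all
          also have "\<dots> = real n * real (q + 1) * \<eta> * real M * real M * real L + real n * C'"
            by (simp add: power2_eq_square algebra_simps)
          finally show "\<epsilon> * real (card (Bad N)) * real M * real L
              \<le> real n * real (q + 1) * \<eta> * real M * real M * real L + real n * C'" .
        qed
        then have "\<epsilon> * real (card (Bad N)) \<le> real n * real (q + 1) * \<eta> * real M"
          using M0 by (simp add: mult_le_cancel_right)
        also have "\<dots> = (real n * \<eta>) * (real (q + 1) * real M)" by (simp only: mult_ac)
        also have "\<dots> \<le> (real n * \<eta>) * (3 * real N)" using q \<eta> by (intro mult_left_mono) auto
        finally show ?thesis by (simp add: mult_ac)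
      qed
      with M0 show ?thesis by blast
    qed
    have "(\<lambda>N. real (card (Good \<inter> {1..N})) / real N) \<longlonglongrightarrow> 1"
    proof (rule LIMSEQ_I)
      fix \<delta> :: real assume \<delta>: "\<delta> > 0"
      define \<eta> where "\<eta> = \<delta> * \<epsilon> / (3 * (real n + 1))"
      have \<eta>: "\<eta> > 0" using \<delta> \<epsilon> by (simp add: \<eta>_def)
      have \<eta>3: "3 * real n * \<eta> < \<epsilon> * \<delta>"
      proof -
        have "3 * (real n + 1) * \<eta> = \<epsilon> * \<delta>" by (simp add: \<eta>_def)
        moreover have "3 * real n * \<eta> < 3 * (real n + 1) * \<eta>" using \<eta> by simp
        ultimately show ?thesis by simp
      qed
      obtain M where M: "M > 0" "\<And>N. N \<ge> M \<Longrightarrow> \<epsilon> * real (card (Bad N)) \<le> 3 * real n * \<eta> * real N"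
        using bad[OF \<eta>] by blast
      have "norm (real (card (Good \<inter> {1..N})) / real N - 1) < \<delta>" if N: "N \<ge> M" for N
      proof -
        have N0: "real N > 0" using N M(1) by simp
        have "card (Good \<inter> {1..N}) + card (Bad N) = card {1..N}"
          unfolding Bad_def using card_Int_Diff[of "{1..N}" Good] by (simp add: Int_commute)
        then have "real (card (Good \<inter> {1..N})) = real N - real (card (Bad N))" by simp
        then have eq: "real (card (Good \<inter> {1..N})) / real N - 1 = - (real (card (Bad N)) / real N)"
          using N0 by (simp add: diff_divide_distrib)
        have "\<epsilon> * real (card (Bad N)) < \<epsilon> * (\<delta> * real N)"
          using M(2)[OF N] mult_strict_right_mono[OF \<eta>3 N0] by (simp add: mult_ac)
        then have "real (card (Bad N)) / real N < \<delta>" using \<epsilon> N0 by (simp add: pos_divide_less_eq)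
        then show ?thesis unfolding eq by simp
      qed
      then show "\<exists>M. \<forall>N\<ge>M. norm (real (card (Good \<inter> {1..N})) / real N - 1) < \<delta>" by blast
    qed
    then show ?thesis by (simp add: has_nat_density_def Good_def)
  qed
  then show "\<exists>d :: nat \<Rightarrow> real.
           (\<forall>\<^sub>F n in sequentially.
              has_nat_density {k. k \<ge> 1 \<and> e_kn (theta_of s) k n > 1 - \<epsilon>} (d n))
           \<and> d \<longlonglongrightarrow> 1"
    by (intro exI[of _ "\<lambda>_. 1"] conjI) auto
qed

end
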